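(* Let $(G,\sigma)$ be a flow-admissible signed eulerian graph with an even number of negative edges. If $(G,\sigma)$ contains no long barbells, then $E(G)$ has a decomposition $\mathcal{C}$ into edge-disjoint subgraphs such that each member of $\mathcal{C}$ is either a balanced circuit or a short barbell.
   Context: A signed graph $(G,\sigma)$ is a graph $G$ with a signature $\sigma:E(G)\to\{-1,+1\}$; edges with $\sigma(e)=-1$ are negative. A circuit (connected $2$-regular subgraph) is balanced if it contains an even number of negative edges and unbalanced otherwise. A short barbell is the union of two unbalanced circuits that meet at exactly one vertex. A long barbell is the union of two vertex-disjoint unbalanced circuits together with a path meeting the circuits only at its two ends. Eulerian means every vertex has even degree. Each edge $e=uv$ consists of half-edges $h_e^u$ and $h_e^v$; $H(v)$ is the set of half-edges at $v$; an orientation is a map $\tau$ from half-edges to $\{\pm1\}$ with $\tau(h_e^u)\tau(h_e^v)=-\sigma(e)$. A nowhere-zero $k$-flow is an orientation $\tau$ with $f:E(G)\to\mathbb{Z}$, $1\le|f(e)|\le k-1$, and $\sum_{h\in H(v)}\tau(h)f(e_h)=0$ for every vertex $v$ ($e_h$ the edge containing $h$); $(G,\sigma)$ is flow-admissible if it admits a nowhere-zero $k$-flow for some integer $k$.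
   Formalization: The graph is assumed connected, as eulerian graphs usually are; with even degrees alone the claim fails, e.g. for two vertices carrying three negative loops each. Disconnected graphs whose components each have an even number of negative edges follow componentwise. *)

theory Defs
  imports Main
begin

text \<open>
  Graphs are undirected and may have parallel edges and loops.  Every edge \<open>e\<close> consists of the two
  half-edges \<open>(e, False)\<close> and \<open>(e, True)\<close>; \<open>endp G h\<close> is the vertex at which the half-edge \<open>h\<close>
  is attached.  The Boolean only distinguishes the two half-edges of an edge (needed for loops) and
  carries no direction.
\<close>

record ('v, 'e) graph =
  verts :: "'v set"
  edges :: "'e set"
  endp :: "'e \<times> bool \<Rightarrow> 'v"

definition half_edges :: "('v, 'e) graph \<Rightarrow> ('e \<times> bool) set" where
  "half_edges G = edges G \<times> UNIV"

definition finite_graph :: "('v, 'e) graph \<Rightarrow> bool" where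
  "finite_graph G \<longleftrightarrow> finite (verts G) \<and> finite (edges G) \<and>
     (\<forall>h\<in>half_edges G. endp G h \<in> verts G)"

definition half_edges_at :: "('v, 'e) graph \<Rightarrow> 'v \<Rightarrow> ('e \<times> bool) set" where
  "half_edges_at G v = {h \<in> half_edges G. endp G h = v}"

definition ends :: "('v, 'e) graph \<Rightarrow> 'e \<Rightarrow> 'v set" where
  "ends G e = {endp G (e, False), endp G (e, True)}"

text \<open>A loop contributes two to the degree of its vertex.\<close>

definition degree :: "('v, 'e) graph \<Rightarrow> 'v \<Rightarrow> nat" where
  "degree G v = card (half_edges_at G v)"

definition eulerian :: "('v, 'e) graph \<Rightarrow> bool" where
  "eulerian G \<longleftrightarrow> (\<forall>v\<in>verts G. even (degree G v))"

definition adj_rel :: "('v, 'e) graph \<Rightarrow> ('v \<times> 'v) set" where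
  "adj_rel G = {(u, v). \<exists>e\<in>edges G. ends G e = {u, v}}"

definition connected_graph :: "('v, 'e) graph \<Rightarrow> bool" where
  "connected_graph G \<longleftrightarrow>
     verts G \<noteq> {} \<and> (\<forall>u\<in>verts G. \<forall>v\<in>verts G. (u, v) \<in> (adj_rel G)\<^sup>*)"

definition subgraph :: "('v, 'e) graph \<Rightarrow> ('v, 'e) graph \<Rightarrow> bool" where
  "subgraph H G \<longleftrightarrow> finite_graph H \<and> verts H \<subseteq> verts G \<and> edges H \<subseteq> edges G \<and> endp H = endp G"

definition union_of :: "('v, 'e) graph \<Rightarrow> ('v, 'e) graph set \<Rightarrow> bool" where
  "union_of B \<H> \<longleftrightarrow> (\<forall>H\<in>\<H>. subgraph H B) \<and>
     verts B = (\<Union>H\<in>\<H>. verts H) \<and> edges B = (\<Union>H\<in>\<H>. edges H)"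

definition circuit :: "('v, 'e) graph \<Rightarrow> bool" where
  "circuit C \<longleftrightarrow> finite_graph C \<and> connected_graph C \<and> (\<forall>v\<in>verts C. degree C v = 2)"

text \<open>\<open>P\<close> is a path with end vertices \<open>u\<close> and \<open>v\<close>; as its vertices are pairwise distinct, it
  has no repeated edges and no loops.\<close>

definition path_graph :: "('v, 'e) graph \<Rightarrow> 'v \<Rightarrow> 'v \<Rightarrow> bool" where
  "path_graph P u v \<longleftrightarrow> (\<exists>vs es.
     length vs = Suc (length es) \<and> distinct vs \<and> hd vs = u \<and> last vs = v \<and>
     verts P = set vs \<and> edges P = set es \<and>
     (\<forall>i<length es. ends P (es ! i) = {vs ! i, vs ! Suc i}))"

definition signature :: "('v, 'e) graph \<Rightarrow> ('e \<Rightarrow> int) \<Rightarrow> bool" where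
  "signature G \<sigma> \<longleftrightarrow> (\<forall>e\<in>edges G. \<sigma> e \<in> {-1, 1})"

definition neg_edges :: "('v, 'e) graph \<Rightarrow> ('e \<Rightarrow> int) \<Rightarrow> 'e set" where
  "neg_edges G \<sigma> = {e \<in> edges G. \<sigma> e = -1}"

definition balanced_circuit :: "('e \<Rightarrow> int) \<Rightarrow> ('v, 'e) graph \<Rightarrow> bool" where
  "balanced_circuit \<sigma> C \<longleftrightarrow> circuit C \<and> even (card (neg_edges C \<sigma>))"

definition unbalanced_circuit :: "('e \<Rightarrow> int) \<Rightarrow> ('v, 'e) graph \<Rightarrow> bool" where
  "unbalanced_circuit \<sigma> C \<longleftrightarrow> circuit C \<and> odd (card (neg_edges C \<sigma>))"

text \<open>Disjointness of the edge sets only matters for loops: it excludes taking one and the same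
  negative loop for both \<open>C\<^sub>1\<close> and \<open>C\<^sub>2\<close>.\<close>

definition short_barbell :: "('e \<Rightarrow> int) \<Rightarrow> ('v, 'e) graph \<Rightarrow> bool" where
  "short_barbell \<sigma> B \<longleftrightarrow> (\<exists>C\<^sub>1 C\<^sub>2 x.
     unbalanced_circuit \<sigma> C\<^sub>1 \<and> unbalanced_circuit \<sigma> C\<^sub>2 \<and>
     verts C\<^sub>1 \<inter> verts C\<^sub>2 = {x} \<and> edges C\<^sub>1 \<inter> edges C\<^sub>2 = {} \<and>
     union_of B {C\<^sub>1, C\<^sub>2})"

definition long_barbell :: "('e \<Rightarrow> int) \<Rightarrow> ('v, 'e) graph \<Rightarrow> bool" where
  "long_barbell \<sigma> B \<longleftrightarrow> (\<exists>C\<^sub>1 C\<^sub>2 P u v.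
     unbalanced_circuit \<sigma> C\<^sub>1 \<and> unbalanced_circuit \<sigma> C\<^sub>2 \<and> verts C\<^sub>1 \<inter> verts C\<^sub>2 = {} \<and>
     path_graph P u v \<and> verts P \<inter> verts C\<^sub>1 = {u} \<and> verts P \<inter> verts C\<^sub>2 = {v} \<and>
     union_of B {C\<^sub>1, C\<^sub>2, P})"

definition orientation ::
  "('v, 'e) graph \<Rightarrow> ('e \<Rightarrow> int) \<Rightarrow> ('e \<times> bool \<Rightarrow> int) \<Rightarrow> bool" where
  "orientation G \<sigma> \<tau> \<longleftrightarrow> (\<forall>h\<in>half_edges G. \<tau> h \<in> {-1, 1}) \<and>
     (\<forall>e\<in>edges G. \<tau> (e, False) * \<tau> (e, True) = - \<sigma> e)"

definition nowhere_zero_flow ::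
  "('v, 'e) graph \<Rightarrow> ('e \<Rightarrow> int) \<Rightarrow> int \<Rightarrow> ('e \<times> bool \<Rightarrow> int) \<Rightarrow> ('e \<Rightarrow> int) \<Rightarrow> bool" where
  "nowhere_zero_flow G \<sigma> k \<tau> f \<longleftrightarrow> orientation G \<sigma> \<tau> \<and>
     (\<forall>e\<in>edges G. 1 \<le> \<bar>f e\<bar> \<and> \<bar>f e\<bar> \<le> k - 1) \<and>
     (\<forall>v\<in>verts G. (\<Sum>h\<in>half_edges_at G v. \<tau> h * f (fst h)) = 0)"

definition flow_admissible :: "('v, 'e) graph \<Rightarrow> ('e \<Rightarrow> int) \<Rightarrow> bool" where
  "flow_admissible G \<sigma> \<longleftrightarrow> (\<exists>k \<tau> f. nowhere_zero_flow G \<sigma> k \<tau> f)"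

definition decomposition :: "('v, 'e) graph \<Rightarrow> ('v, 'e) graph set \<Rightarrow> bool" where
  "decomposition G \<C> \<longleftrightarrow> (\<forall>H\<in>\<C>. subgraph H G) \<and>
     (\<forall>H\<in>\<C>. \<forall>K\<in>\<C>. H \<noteq> K \<longrightarrow> edges H \<inter> edges K = {}) \<and>
     (\<Union>H\<in>\<C>. edges H) = edges G"

end

theory Submission imports Defs begin

text \<open>
  Two edge-disjoint unbalanced circuits of \<open>G\<close> always share a vertex, because otherwise connectedness
  yields a long barbell.  If they share exactly one vertex, they form a short barbell.  If they share
  at least two, a segment of the first circuit joins two vertices of the second one and is otherwise
  disjoint from it; the two arcs into which it cuts the second circuit have different parities, so
  it forms a balanced circuit with one of them.  Hence every nonempty edge set with even degrees and
  an even number of negative edges contains a balanced circuit or a short barbell, which can be split off.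
\<close>

section \<open>Degrees and adjacency in edge sets\<close>

text \<open>The degree is taken over a bare edge set, so that removing edges needs no new graph. A
  loop counts twice because both summands are 1.\<close>

definition edge_deg :: "('e \<times> bool \<Rightarrow> 'v) \<Rightarrow> 'e set \<Rightarrow> 'v \<Rightarrow> nat" where
  "edge_deg ep F z = (\<Sum>e\<in>F. of_bool (ep (e, False) = z) + of_bool (ep (e, True) = z))"

definition edge_adj :: "('e \<times> bool \<Rightarrow> 'v) \<Rightarrow> 'e set \<Rightarrow> ('v \<times> 'v) set" where
  "edge_adj ep F = {(u, v). \<exists>e\<in>F. {ep (e, False), ep (e, True)} = {u, v}}"

lemma adj_rel_eq_edge_adj: "adj_rel G = edge_adj (endp G) (edges G)"
  by (simp add: adj_rel_def edge_adj_def ends_def)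

lemma edge_adj_mono: "E \<subseteq> F \<Longrightarrow> edge_adj ep E \<subseteq> edge_adj ep F"
  by (auto simp: edge_adj_def)

lemma edge_adj_rtrancl_sym: "(a, b) \<in> (edge_adj ep F)\<^sup>* \<Longrightarrow> (b, a) \<in> (edge_adj ep F)\<^sup>*"
proof -
  have "sym (edge_adj ep F)"
    by (auto simp: sym_def edge_adj_def insert_commute)
  then show "(a, b) \<in> (edge_adj ep F)\<^sup>* \<Longrightarrow> (b, a) \<in> (edge_adj ep F)\<^sup>*"
    by (meson sym_rtrancl symD)
qed

lemma degree_eq_edge_deg:
  assumes "finite (edges G)"
  shows "degree G z = edge_deg (endp G) (edges G) z"
proof -
  have "half_edges_at G z =
      (\<Union>e\<in>edges G. (Pair e) ` {b. endp G (e, b) = z})"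
    by (auto simp: half_edges_at_def half_edges_def)
  then have "degree G z = (\<Sum>e\<in>edges G. card ((Pair e) ` {b. endp G (e, b) = z}))"
    unfolding degree_def using assms by (simp add: card_UN_disjoint disjoint_iff image_iff)
  also have "\<dots> = (\<Sum>e\<in>edges G. card {b. endp G (e, b) = z})"
    by (intro sum.cong refl card_image) (simp add: inj_on_def)
  also have "\<dots> = edge_deg (endp G) (edges G) z"
  proof -
    have "card {b. P b} = of_bool (P False) + of_bool (P True)" for P :: "bool \<Rightarrow> bool"
    proof -
      have "{b. P b} = (if P False then {False} else {}) \<union> (if P True then {True} else {})"
        by (auto split: if_splits) (metis (full_types))+
      then show ?thesis by simp
    qed
    then show ?thesis by (simp add: edge_deg_def)
  qed
  finally show ?thesis .
qed

lemma edge_deg_Un: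
  "finite E \<Longrightarrow> finite F \<Longrightarrow> E \<inter> F = {} \<Longrightarrow> edge_deg ep (E \<union> F) z = edge_deg ep E z + edge_deg ep F z"
  by (simp add: edge_deg_def sum.union_disjoint)

lemma edge_deg_Diff:
  "finite F \<Longrightarrow> E \<subseteq> F \<Longrightarrow> edge_deg ep F z = edge_deg ep (F - E) z + edge_deg ep E z"
  unfolding edge_deg_def by (rule sum.subset_diff)

lemma edge_deg_eq_0_iff:
  "finite F \<Longrightarrow> edge_deg ep F z = 0 \<longleftrightarrow> (\<forall>e\<in>F. ep (e, False) \<noteq> z \<and> ep (e, True) \<noteq> z)"
  by (auto simp: edge_deg_def)

lemma edge_deg_mono: "finite F \<Longrightarrow> E \<subseteq> F \<Longrightarrow> edge_deg ep E z \<le> edge_deg ep F z"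
  unfolding edge_deg_def by (rule sum_mono2) auto

text \<open>The handshake lemma for the component of \<open>x\<close>.\<close>

lemma odd_vertices_connected:
  assumes fin: "finite F" and odd: "odd (edge_deg ep F x)"
    and even: "\<And>z. z \<noteq> x \<Longrightarrow> z \<noteq> y \<Longrightarrow> even (edge_deg ep F z)"
  shows "(x, y) \<in> (edge_adj ep F)\<^sup>*"
proof (rule ccontr)
  assume neg: "(x, y) \<notin> (edge_adj ep F)\<^sup>*"
  \<comment> \<open>\<open>K\<close> is the component of \<open>x\<close>, cut down to
    \<open>x\<close> and the ends of edges in \<open>F\<close> to keep it finite.\<close>
  define K where "K = {z \<in> insert x (ep ` (F \<times> UNIV)). (x, z) \<in> (edge_adj ep F)\<^sup>*}"
  have K: "finite K" "x \<in> K" "y \<notin> K"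
    using fin neg by (auto simp: K_def)
  have both: "ep (e, False) \<in> K \<longleftrightarrow> ep (e, True) \<in> K" if "e \<in> F" for e
  proof -
    have "(ep (e, False), ep (e, True)) \<in> edge_adj ep F" "(ep (e, True), ep (e, False)) \<in> edge_adj ep F"
      using that by (auto simp: edge_adj_def)
    then show ?thesis
      using that by (auto simp: K_def intro: rtrancl_into_rtrancl)
  qed
  \<comment> \<open>Double counting: by \<open>both\<close>, an edge has both ends in
    \<open>K\<close> or neither, so it contributes 2 or 0.\<close>
  have "(\<Sum>z\<in>K. edge_deg ep F z) =
      (\<Sum>e\<in>F. \<Sum>z\<in>K. of_bool (ep (e, False) = z) + of_bool (ep (e, True) = z))"
    unfolding edge_deg_def by (rule sum.swap)
  also have "\<dots> = (\<Sum>e\<in>F. 2 * of_bool (ep (e, False) \<in> K))"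
    using K(1) both by (intro sum.cong refl) (simp add: sum.distrib of_bool_def)
  finally have "even (\<Sum>z\<in>K. edge_deg ep F z)"
    by (simp add: sum_distrib_left [symmetric])
  moreover have "(\<Sum>z\<in>K. edge_deg ep F z) = edge_deg ep F x + (\<Sum>z\<in>K - {x}. edge_deg ep F z)"
    using K by (simp add: sum.remove)
  moreover have "even (\<Sum>z\<in>K - {x}. edge_deg ep F z)"
    using even K by (intro dvd_sum) auto
  ultimately show False using odd by simp
qed

section \<open>Simple paths\<close>

text \<open>The end \<open>v\<close> is fixed and the path grows at \<open>u\<close>. Carrying the
  vertex and edge sets allows induction without lists; \<open>u\<close> outside \<open>V\<close>
  keeps vertices distinct and rules out loops.\<close>

inductive simple_path :: "('e \<times> bool \<Rightarrow> 'v) \<Rightarrow> 'v \<Rightarrow> 'v \<Rightarrow> 'v set \<Rightarrow> 'e set \<Rightarrow> bool" for ep v where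
  refl: "simple_path ep v v {v} {}"
| step: "simple_path ep v w V E \<Longrightarrow> {ep (e, False), ep (e, True)} = {u, w} \<Longrightarrow> u \<notin> V \<Longrightarrow>
    simple_path ep v u (insert u V) (insert e E)"

lemma simple_path_finite: "simple_path ep v u V E \<Longrightarrow> finite V \<and> finite E"
  by (induction rule: simple_path.induct) auto

lemma simple_path_ends_mem: "simple_path ep v u V E \<Longrightarrow> u \<in> V \<and> v \<in> V"
  by (induction rule: simple_path.induct) auto

lemma simple_path_incident: "simple_path ep v u V E \<Longrightarrow> e \<in> E \<Longrightarrow> ep (e, b) \<in> V"
proof (induction arbitrary: b rule: simple_path.induct)
  case (step w V E e' u)
  show ?case
  proof (cases "e = e'")
    case True
    have "ep (e, b) \<in> {ep (e, False), ep (e, True)}" by (cases b) auto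
    then show ?thesis using step.hyps simple_path_ends_mem[OF step.hyps(1)] True by auto
  qed (use step in auto)
qed simp

text \<open>Also correct for the trivial path \<open>u = v\<close>, where both correction terms fall on one vertex.\<close>

lemma simple_path_deg:
  "simple_path ep v u V E \<Longrightarrow>
    edge_deg ep E z + of_bool (z = u) + of_bool (z = v) = 2 * of_bool (z \<in> V)"
proof (induction rule: simple_path.induct)
  case refl
  then show ?case by (simp add: edge_deg_def)
next
  case (step w V E e u)
  have w: "w \<in> V" using simple_path_ends_mem[OF step.hyps(1)] by simp
  \<comment> \<open>The new edge has the end \<open>u\<close> outside \<open>V\<close>, while edges
    of \<open>E\<close> have both ends in \<open>V\<close>.\<close>
  have "e \<notin> E"
    using simple_path_incident[OF step.hyps(1)] step.hyps by (metis doubleton_eq_iff)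
  then have "edge_deg ep (insert e E) z =
      of_bool (ep (e, False) = z) + of_bool (ep (e, True) = z) + edge_deg ep E z"
    using simple_path_finite[OF step.hyps(1)] by (simp add: edge_deg_def)
  moreover have "of_bool (ep (e, False) = z) + of_bool (ep (e, True) = z) =
      (of_bool (z = u) + of_bool (z = w) :: nat)"
    using step.hyps(2) by (auto simp: doubleton_eq_iff)
  ultimately show ?case using step.IH step.hyps(3) w by (auto simp: of_bool_def split: if_splits)
qed

lemma simple_path_connected:
  "simple_path ep v u V E \<Longrightarrow> z \<in> V \<Longrightarrow> (z, v) \<in> (edge_adj ep E)\<^sup>*"
proof (induction arbitrary: z rule: simple_path.induct)
  case (step w V E e u)
  have mono: "(edge_adj ep E)\<^sup>* \<subseteq> (edge_adj ep (insert e E))\<^sup>*"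
    by (intro rtrancl_mono edge_adj_mono) auto
  show ?case
  proof (cases "z = u")
    case True
    have "(u, w) \<in> edge_adj ep (insert e E)" using step.hyps by (auto simp: edge_adj_def)
    moreover have "(w, v) \<in> (edge_adj ep (insert e E))\<^sup>*"
      using step.IH[of w] mono simple_path_ends_mem[OF step.hyps(1)] by auto
    ultimately show ?thesis using True by (simp add: converse_rtrancl_into_rtrancl)
  qed (use step mono in auto)
qed simp

text \<open>Walking from \<open>v\<close> towards \<open>u\<close>, stop at the first vertex of
  \<open>S\<close>. The induction keeps the whole path only if the shorter one misses
  \<open>S\<close>.\<close>

lemma simple_path_suffix:
  "simple_path ep v u V E \<Longrightarrow> V \<inter> S \<noteq> {} \<Longrightarrow>
    \<exists>u' V' E'. simple_path ep v u' V' E' \<and> V' \<subseteq> V \<and> E' \<subseteq> E \<and> V' \<inter> S = {u'}"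
proof (induction rule: simple_path.induct)
  case refl
  then show ?case by (intro exI[of _ v] exI[of _ "{v}"] exI[of _ "{}"]) (auto intro: simple_path.refl)
next
  case (step w V E e u)
  show ?case
  proof (cases "V \<inter> S = {}")
    case True
    then have "insert u V \<inter> S = {u}" using step.prems by auto
    then show ?thesis using simple_path.step[OF step.hyps] by blast
  next
    case False
    then show ?thesis using step.IH by blast
  qed
qed

text \<open>A path is first built that meets \<open>T\<close> only in its end \<open>v'\<close>;
  cutting it at its first vertex in \<open>S\<close>, seen from \<open>v'\<close>, retains
  \<open>v'\<close> and so preserves the condition on \<open>T\<close>.\<close>

lemma simple_path_between:
  assumes "(u, v) \<in> (edge_adj ep F)\<^sup>*" "u \<in> S" "v \<in> T"
  obtains u' v' V E where "simple_path ep v' u' V E" "E \<subseteq> F" "V \<inter> S = {u'}" "V \<inter> T = {v'}"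
proof -
  have "\<exists>v' V E. simple_path ep v' u V E \<and> E \<subseteq> F \<and> V \<inter> T = {v'}"
    using assms(1)
  proof (induction rule: converse_rtrancl_induct)
    case base
    show ?case using simple_path.refl[of ep v] assms(3) by blast
  next
    case (step y w)
    then obtain v' V E where P: "simple_path ep v' w V E" "E \<subseteq> F" "V \<inter> T = {v'}" by blast
    obtain e where e: "e \<in> F" "{ep (e, False), ep (e, True)} = {y, w}"
      using step.hyps by (auto simp: edge_adj_def)
    \<comment> \<open>Prepending \<open>y\<close> to the path from \<open>w\<close>: if
      \<open>y\<close> lies in \<open>T\<close>, restart with the trivial path; if it is already on
      the path, cut back to it; otherwise extend.\<close>
    consider "y \<in> T" | "y \<in> V" | "y \<notin> T" "y \<notin> V" by blast
    then show ?case
    proof cases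
      case 1
      then show ?thesis using simple_path.refl[of ep y] by blast
    next
      case 2
      then obtain u' V' E' where Q: "simple_path ep v' u' V' E'" "V' \<subseteq> V" "E' \<subseteq> E" "V' \<inter> {y} = {u'}"
        using simple_path_suffix[OF P(1), of "{y}"] by blast
      have "u' = y" using Q(4) by blast
      moreover have "V' \<inter> T = {v'}" using Q(2) P(3) simple_path_ends_mem[OF Q(1)] by blast
      ultimately show ?thesis using Q P(2) by blast
    next
      case 3
      have "simple_path ep v' y (insert y V) (insert e E)"
        using simple_path.step P(1) e(2) 3(2) by metis
      moreover have "insert y V \<inter> T = {v'}" using P(3) 3 by blast
      ultimately show ?thesis using e(1) P(2) by blast
    qed
  qed
  then obtain v' V E where P: "simple_path ep v' u V E" "E \<subseteq> F" "V \<inter> T = {v'}" by blast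
  obtain u' V' E' where Q: "simple_path ep v' u' V' E'" "V' \<subseteq> V" "E' \<subseteq> E" "V' \<inter> S = {u'}"
    using simple_path_suffix[OF P(1), of S] simple_path_ends_mem[OF P(1)] assms(2) by blast
  have "V' \<inter> T = {v'}" using Q(2) P(3) simple_path_ends_mem[OF Q(1)] by blast
  then show thesis using that Q P(2) by blast
qed

corollary simple_path_of_connected:
  assumes "(u, v) \<in> (edge_adj ep F)\<^sup>*"
  obtains V E where "simple_path ep v u V E" "E \<subseteq> F"
proof -
  obtain u' v' V E where P: "simple_path ep v' u' V E" "E \<subseteq> F" "V \<inter> {u} = {u'}" "V \<inter> {v} = {v'}"
    by (rule simple_path_between[OF assms singletonI singletonI])
  then have "u' = u" "v' = v" by blast+
  with P that show thesis by blast
qed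

text \<open>This translates the inductive paths into the list form that \<open>path_graph\<close>
  demands; it serves only to exhibit the path of a long barbell.\<close>

lemma simple_path_lists:
  "simple_path ep v u V E \<Longrightarrow>
    \<exists>vs es. length vs = Suc (length es) \<and> distinct vs \<and> hd vs = u \<and> last vs = v \<and>
      V = set vs \<and> E = set es \<and>
      (\<forall>i<length es. {ep (es ! i, False), ep (es ! i, True)} = {vs ! i, vs ! Suc i})"
proof (induction rule: simple_path.induct)
  case refl
  show ?case by (intro exI[of _ "[v]"] exI[of _ "[]"]) auto
next
  case (step w V E e u)
  then obtain vs es where IH: "length vs = Suc (length es)" "distinct vs" "hd vs = w" "last vs = v"
      "V = set vs" "E = set es"
      "\<And>i. i < length es \<Longrightarrow> {ep (es ! i, False), ep (es ! i, True)} = {vs ! i, vs ! Suc i}"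
    by blast
  have ne: "vs \<noteq> []" using IH(1) by auto
  have "{ep ((e # es) ! i, False), ep ((e # es) ! i, True)} = {(u # vs) ! i, (u # vs) ! Suc i}"
    if "i < length (e # es)" for i
  proof (cases i)
    case 0
    then show ?thesis using step.hyps(2) IH(3) ne by (simp add: hd_conv_nth)
  next
    case (Suc j)
    then show ?thesis using IH(7)[of j] that by simp
  qed
  then show ?case
    using IH(1-6) ne step.hyps(3) by (intro exI[of _ "u # vs"] exI[of _ "e # es"]) auto
qed

lemma path_graph_of_simple_path:
  "simple_path ep v u V E \<Longrightarrow> path_graph \<lparr>verts = V, edges = E, endp = ep\<rparr> u v"
  using simple_path_lists[of ep v u V E] by (simp add: path_graph_def ends_def)

section \<open>Circuits\<close>

text \<open>Stating the degree for every \<open>z\<close>, on or off the circuit, lets later parity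
  computations run without membership side conditions.\<close>

lemma circuit_deg:
  assumes "circuit C"
  shows "edge_deg (endp C) (edges C) z = 2 * of_bool (z \<in> verts C)"
proof (cases "z \<in> verts C")
  case True
  then show ?thesis
    using assms degree_eq_edge_deg[of C z] by (simp add: circuit_def finite_graph_def)
next
  case False
  then show ?thesis
    using assms edge_deg_eq_0_iff[of "edges C" "endp C" z]
    by (auto simp: circuit_def finite_graph_def half_edges_def)
qed

lemma circuit_finite: "circuit C \<Longrightarrow> finite (edges C)"
  by (simp add: circuit_def finite_graph_def)

lemma circuit_edges_nonempty: "circuit C \<Longrightarrow> edges C \<noteq> {}"
proof
  assume C: "circuit C" "edges C = {}"
  then obtain z where "z \<in> verts C" by (auto simp: circuit_def connected_graph_def)
  then show False using circuit_deg[OF C(1), of z] C(2) by (simp add: edge_deg_def)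
qed

lemma circuit_connected:
  "circuit C \<Longrightarrow> x \<in> verts C \<Longrightarrow> y \<in> verts C \<Longrightarrow> (x, y) \<in> (edge_adj (endp C) (edges C))\<^sup>*"
  by (simp add: circuit_def connected_graph_def adj_rel_eq_edge_adj)

lemma circuitI:
  assumes "finite V" "finite E" "\<And>e b. e \<in> E \<Longrightarrow> ep (e, b) \<in> V" "v \<in> V"
    "\<And>z. z \<in> V \<Longrightarrow> (z, v) \<in> (edge_adj ep E)\<^sup>*" "\<And>z. z \<in> V \<Longrightarrow> edge_deg ep E z = 2"
  shows "circuit \<lparr>verts = V, edges = E, endp = ep\<rparr>"
proof -
  have "(a, b) \<in> (edge_adj ep E)\<^sup>*" if "a \<in> V" "b \<in> V" for a b
    using assms(5)[OF that(1)] edge_adj_rtrancl_sym[OF assms(5)[OF that(2)]] by (rule rtrancl_trans)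
  then show ?thesis
    using assms by (auto simp: circuit_def connected_graph_def finite_graph_def half_edges_def
        adj_rel_eq_edge_adj degree_eq_edge_deg)
qed

text \<open>Each path contributes 1 to the degree of \<open>u\<close> and of \<open>v\<close>, and
  any other vertex gets 2 from the one path containing it. Disjointness of \<open>E\<close> and
  \<open>E'\<close> is a separate condition because two paths sharing just their ends could be the
  same single edge.\<close>

lemma circuit_of_two_paths:
  assumes P: "simple_path ep v u V E" and Q: "simple_path ep v u V' E'"
    and "V \<inter> V' = {u, v}" "E \<inter> E' = {}" "u \<noteq> v"
  shows "circuit \<lparr>verts = V \<union> V', edges = E \<union> E', endp = ep\<rparr>"
proof (rule circuitI)
  show "finite (V \<union> V')" "finite (E \<union> E')"
    using simple_path_finite[OF P] simple_path_finite[OF Q] by auto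
  show "ep (e, b) \<in> V \<union> V'" if "e \<in> E \<union> E'" for e b
    using that simple_path_incident[OF P] simple_path_incident[OF Q] by blast
  show "v \<in> V \<union> V'" using simple_path_ends_mem[OF P] by auto
  show "(z, v) \<in> (edge_adj ep (E \<union> E'))\<^sup>*" if "z \<in> V \<union> V'" for z
    using that simple_path_connected[OF P, of z] simple_path_connected[OF Q, of z]
      rtrancl_mono[OF edge_adj_mono[of E "E \<union> E'" ep]] rtrancl_mono[OF edge_adj_mono[of E' "E \<union> E'" ep]]
    by blast
  show "edge_deg ep (E \<union> E') z = 2" if "z \<in> V \<union> V'" for z
  proof -
    have "edge_deg ep (E \<union> E') z = edge_deg ep E z + edge_deg ep E' z"
      using simple_path_finite[OF P] simple_path_finite[OF Q] assms by (simp add: edge_deg_Un)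
    moreover have "z \<in> V \<and> z \<in> V' \<longleftrightarrow> z = u \<or> z = v" using assms(3) by blast
    ultimately show ?thesis
      using simple_path_deg[OF P, of z] simple_path_deg[OF Q, of z] that assms(5)
      by (auto simp: of_bool_def split: if_splits)
  qed
qed

text \<open>A loop is itself a circuit. Deleting a non-loop \<open>e\<close> leaves its ends as the
  only vertices of odd degree, so a path avoiding \<open>e\<close> joins them, and \<open>e\<close>
  closes it.\<close>

lemma even_edge_set_contains_circuit:
  assumes fin: "finite F" and "F \<noteq> {}" and even: "\<And>z. even (edge_deg ep F z)"
  obtains C where "circuit C" "edges C \<subseteq> F" "endp C = ep"
proof -
  obtain e where e: "e \<in> F" using assms by blast
  define u w where "u = ep (e, False)" and "w = ep (e, True)"
  show thesis
  proof (cases "u = w")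
    case True
    have "circuit \<lparr>verts = {u}, edges = {e}, endp = ep\<rparr>"
    proof (rule circuitI)
      show "ep (e', b) \<in> {u}" if "e' \<in> {e}" for e' b
        using that True by (cases b) (auto simp: u_def w_def)
    qed (use True in \<open>auto simp: edge_deg_def u_def w_def\<close>)
    then show thesis using that e by (metis empty_subsetI graph.select_convs(2,3) insert_subset)
  next
    case False
    have deg: "edge_deg ep F z = edge_deg ep (F - {e}) z + (of_bool (z = u) + of_bool (z = w))" for z
      using edge_deg_Diff[OF fin, of "{e}" ep z] e by (simp add: edge_deg_def u_def w_def eq_commute)
    have "(w, u) \<in> (edge_adj ep (F - {e}))\<^sup>*"
    proof (rule odd_vertices_connected)
      show "odd (edge_deg ep (F - {e}) w)"
        using deg[of w] even[of w] False by simp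
      show "even (edge_deg ep (F - {e}) z)" if "z \<noteq> w" "z \<noteq> u" for z
        using deg[of z] even[of z] that by simp
    qed (use fin in simp)
    then obtain V E where P: "simple_path ep u w V E" "E \<subseteq> F - {e}"
      by (rule simple_path_of_connected)
    have Q: "simple_path ep u w {w, u} {e}"
      using simple_path.step[OF simple_path.refl[of ep u], of e w] False
      by (simp add: u_def w_def insert_commute)
    have "circuit \<lparr>verts = V \<union> {w, u}, edges = E \<union> {e}, endp = ep\<rparr>"
      using circuit_of_two_paths[OF P(1) Q] P(2) False simple_path_ends_mem[OF P(1)] by blast
    then show thesis using that P(2) e
      by (metis Un_insert_right Diff_subset graph.select_convs(2,3) insert_subset le_sup_iff order_trans sup_bot_right)
  qed
qed

text \<open>A vertex touched by \<open>D\<close> has positive even degree in \<open>D\<close>, hence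
  already its full degree 2. So all circuit edges at it lie in \<open>D\<close>, and connectedness
  spreads this to the whole circuit.\<close>

lemma circuit_minimal:
  assumes C: "circuit C" and D: "D \<subseteq> edges C" "D \<noteq> {}"
    and even: "\<And>z. even (edge_deg (endp C) D z)"
  shows "D = edges C"
proof -
  let ?ep = "endp C" and ?E = "edges C"
  have fin: "finite ?E" "finite D" using circuit_finite[OF C] D finite_subset by auto
  have full: "edge_deg ?ep (?E - D) z = 0" if "edge_deg ?ep D z > 0" for z
  proof -
    have "edge_deg ?ep D z \<ge> 2" using even[of z] that by (auto elim: evenE)
    moreover have "edge_deg ?ep ?E z \<le> 2" using circuit_deg[OF C, of z] by (simp add: of_bool_def)
    ultimately show ?thesis using edge_deg_Diff[OF fin(1) D(1), of ?ep z] by linarith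
  qed
  have edge: "e \<in> D" if "e \<in> ?E" "edge_deg ?ep D (?ep (e, b)) > 0" for e b
    using full[OF that(2)] that(1) edge_deg_eq_0_iff[of "?E - D" ?ep] fin by (cases b) auto
  have touched: "edge_deg ?ep D (?ep (e, b)) > 0" if "e \<in> D" for e b
    using that edge_deg_eq_0_iff[OF fin(2), of ?ep "?ep (e, b)"] by (cases b) auto
  obtain e0 where e0: "e0 \<in> D" using D by blast
  have mem: "?ep (e, b) \<in> verts C" if "e \<in> ?E" for e b
    using C that by (auto simp: circuit_def finite_graph_def half_edges_def)
  have all: "edge_deg ?ep D z > 0" if "z \<in> verts C" for z
  proof -
    have "(?ep (e0, False), z) \<in> (edge_adj ?ep ?E)\<^sup>*"
      using circuit_connected[OF C mem that] e0 D(1) by blast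
    then show ?thesis
    proof (induction rule: rtrancl_induct)
      case base
      show ?case using touched[OF e0] .
    next
      case (step y w)
      then obtain e where e: "e \<in> ?E" "{?ep (e, False), ?ep (e, True)} = {y, w}"
        by (auto simp: edge_adj_def)
      obtain b c where bc: "y = ?ep (e, b)" "w = ?ep (e, c)"
        using e(2) by (auto simp: doubleton_eq_iff)
      then show ?case using edge[OF e(1)] touched step.IH by blast
    qed
  qed
  show ?thesis using D(1) edge all mem by blast
qed

text \<open>Removing one path from \<open>y\<close> to \<open>x\<close> leaves odd degree exactly at
  \<open>x\<close> and \<open>y\<close>, which yields a second path. Together the two have even
  degrees, so by \<open>circuit_minimal\<close> they exhaust the circuit.\<close>

lemma circuit_split:
  assumes C: "circuit C" and x: "x \<in> verts C" and y: "y \<in> verts C" and "x \<noteq> y"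
  obtains V1 E1 V2 E2 where "simple_path (endp C) y x V1 E1" "simple_path (endp C) y x V2 E2"
    "V1 \<subseteq> verts C" "V2 \<subseteq> verts C" "E1 \<union> E2 = edges C" "E1 \<inter> E2 = {}"
proof -
  let ?ep = "endp C" and ?E = "edges C"
  note fin = circuit_finite[OF C]
  obtain V1 E1 where P: "simple_path ?ep y x V1 E1" "E1 \<subseteq> ?E"
    using circuit_connected[OF C x y] by (rule simple_path_of_connected)
  have sub: "V \<subseteq> verts C" if "simple_path ?ep y x V E" "E \<subseteq> ?E" for V E
  proof
    fix z assume "z \<in> V"
    then show "z \<in> verts C"
      using simple_path_deg[OF that(1), of z] edge_deg_mono[OF fin that(2), of ?ep z]
        circuit_deg[OF C, of z] x y by (auto simp: of_bool_def split: if_splits)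
  qed
  \<comment> \<open>The identity is kept additive to avoid subtraction on naturals.\<close>
  have deg: "edge_deg ?ep (?E - E1) z + 2 * of_bool (z \<in> V1) =
      2 * of_bool (z \<in> verts C) + of_bool (z = x) + of_bool (z = y)" for z
    using edge_deg_Diff[OF fin P(2), of ?ep z] simple_path_deg[OF P(1), of z] circuit_deg[OF C, of z]
    by linarith
  have V1: "x \<in> V1" "y \<in> V1" using simple_path_ends_mem[OF P(1)] by auto
  have "(x, y) \<in> (edge_adj ?ep (?E - E1))\<^sup>*"
  proof (rule odd_vertices_connected)
    show "odd (edge_deg ?ep (?E - E1) x)"
      using deg[of x] V1 x \<open>x \<noteq> y\<close> by simp
    show "even (edge_deg ?ep (?E - E1) z)" if "z \<noteq> x" "z \<noteq> y" for z
      using deg[of z] that by (auto simp: of_bool_def split: if_splits)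
  qed (use fin in simp)
  then obtain V2 E2 where Q: "simple_path ?ep y x V2 E2" "E2 \<subseteq> ?E - E1"
    by (rule simple_path_of_connected)
  have "edge_deg ?ep (E1 \<union> E2) z = edge_deg ?ep E1 z + edge_deg ?ep E2 z" for z
    using Q(2) simple_path_finite[OF P(1)] simple_path_finite[OF Q(1)] by (intro edge_deg_Un) auto
  then have even: "even (edge_deg ?ep (E1 \<union> E2) z)" for z
    using simple_path_deg[OF P(1), of z] simple_path_deg[OF Q(1), of z]
    by (auto simp: of_bool_def split: if_splits)
  have "E1 \<noteq> {}"
    using simple_path_deg[OF P(1), of x] V1 \<open>x \<noteq> y\<close> by (auto simp: edge_deg_def)
  then have "E1 \<union> E2 = ?E"
    using circuit_minimal[OF C, of "E1 \<union> E2"] even P(2) Q(2) by blast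
  then show thesis using that[OF P(1) Q(1)] sub[OF P(1,2)] sub[OF Q(1)] Q(2) by blast
qed

section \<open>Splitting off balanced circuits and short barbells\<close>

lemma card_neg_Un:
  fixes \<sigma> :: "'e \<Rightarrow> int"
  shows "finite A \<Longrightarrow> finite B \<Longrightarrow> A \<inter> B = {} \<Longrightarrow>
    card {e \<in> A \<union> B. \<sigma> e = -1} = card {e \<in> A. \<sigma> e = -1} + card {e \<in> B. \<sigma> e = -1}"
  by (subst card_Un_disjoint [symmetric]) (auto intro: arg_cong[where f = card])

text \<open>The segment \<open>EA\<close> of \<open>C1\<close> and the arcs \<open>E1\<close>,
  \<open>E2\<close> of \<open>C2\<close> form a theta graph. As \<open>C2\<close> is unbalanced, the
  arcs have different parities, so \<open>EA\<close> matches one of them.\<close>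

lemma balanced_circuit_of_two_common_vertices:
  assumes C1: "unbalanced_circuit \<sigma> C1" and C2: "unbalanced_circuit \<sigma> C2"
    and ep: "endp C1 = ep" "endp C2 = ep" and disj: "edges C1 \<inter> edges C2 = {}"
    and x: "x \<in> verts C1" "x \<in> verts C2" and y: "y \<in> verts C1" "y \<in> verts C2" and "x \<noteq> y"
  obtains C where "balanced_circuit \<sigma> C" "endp C = ep" "edges C \<subseteq> edges C1 \<union> edges C2"
proof -
  have circ: "circuit C1" "circuit C2" using C1 C2 by (auto simp: unbalanced_circuit_def)
  have yT: "y \<in> verts C2 - {x}" using y \<open>x \<noteq> y\<close> by blast
  have "(x, y) \<in> (edge_adj ep (edges C1))\<^sup>*"
    using circuit_connected[OF circ(1) x(1) y(1)] ep by simp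
  \<comment> \<open>Leaving \<open>x\<close> out of the target set excludes the trivial path: the
    segment starts at \<open>x\<close> and stops at its first return \<open>w\<close> to
    \<open>C2\<close>. The vertex \<open>y\<close> only makes the target reachable; \<open>w\<close>
    may differ from it.\<close>
  then obtain x' w VA EA where A: "simple_path ep w x' VA EA" "EA \<subseteq> edges C1"
      "VA \<inter> {x} = {x'}" "VA \<inter> (verts C2 - {x}) = {w}"
    by (rule simple_path_between[OF _ singletonI yT])
  have "x' \<in> VA \<inter> {x}" unfolding A(3) by (rule singletonI)
  then have x': "x' = x" "x \<in> VA" by auto
  have w: "w \<in> verts C2 - {x}" using A(4) by (metis IntD2 singletonI)
  have "VA \<inter> verts C2 = insert x (VA \<inter> (verts C2 - {x}))" using x(2) x'(2) by blast
  then have A': "x' = x" "w \<noteq> x" "w \<in> verts C2" "VA \<inter> verts C2 = {x, w}"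
    using x' w unfolding A(4) by simp_all
  obtain V1 E1 V2 E2 where B: "simple_path ep w x V1 E1" "simple_path ep w x V2 E2"
    "V1 \<subseteq> verts C2" "V2 \<subseteq> verts C2" "E1 \<union> E2 = edges C2" "E1 \<inter> E2 = {}"
    using circuit_split[OF circ(2) x(2) A'(3)] A'(2) ep by metis
  note PA = A(1)[unfolded A'(1)]
  have fin: "finite EA" "finite E1" "finite E2"
    using simple_path_finite[OF PA] simple_path_finite[OF B(1)] simple_path_finite[OF B(2)] by auto
  have theta: "circuit \<lparr>verts = VA \<union> V, edges = EA \<union> E, endp = ep\<rparr>"
    if "simple_path ep w x V E" "V \<subseteq> verts C2" "E \<subseteq> edges C2" for V E
  proof (rule circuit_of_two_paths[OF PA that(1)])
    show "VA \<inter> V = {x, w}"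
      using A'(4) that(2) simple_path_ends_mem[OF that(1)] simple_path_ends_mem[OF PA] by blast
    show "EA \<inter> E = {}" using A(2) that(3) disj by blast
    show "x \<noteq> w" using A'(2) by simp
  qed
  have E: "E1 \<subseteq> edges C2" "E2 \<subseteq> edges C2" "EA \<inter> E1 = {}" "EA \<inter> E2 = {}"
    using B(5) A(2) disj by blast+
  let ?n = "\<lambda>E. card {e \<in> E. \<sigma> e = -1}"
  have "odd (?n (E1 \<union> E2))" using C2 B(5) by (simp add: unbalanced_circuit_def neg_edges_def)
  then have "odd (?n E1 + ?n E2)" using card_neg_Un[OF fin(2,3) B(6), of \<sigma>] by simp
  then consider "even (?n (EA \<union> E1))" | "even (?n (EA \<union> E2))"
    using card_neg_Un[OF fin(1,2) E(3), of \<sigma>] card_neg_Un[OF fin(1,3) E(4), of \<sigma>] by auto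
  then show thesis
  proof cases
    case 1
    show thesis
      using that[of "\<lparr>verts = VA \<union> V1, edges = EA \<union> E1, endp = ep\<rparr>"] 1
        theta[OF B(1,3) E(1)] A(2) E(1) by (auto simp: balanced_circuit_def neg_edges_def)
  next
    case 2
    show thesis
      using that[of "\<lparr>verts = VA \<union> V2, edges = EA \<union> E2, endp = ep\<rparr>"] 2
        theta[OF B(2,4) E(2)] A(2) E(2) by (auto simp: balanced_circuit_def neg_edges_def)
  qed
qed

text \<open>Every vertex of a circuit is an end of one of its edges, so containment of edges carries
  over to vertices.\<close>

lemma circuit_subgraph:
  assumes "finite_graph G" "circuit C" "edges C \<subseteq> edges G" "endp C = endp G"
  shows "subgraph C G"
proof -
  have "z \<in> verts G" if "z \<in> verts C" for z
  proof -
    have "edge_deg (endp C) (edges C) z \<noteq> 0" using circuit_deg[OF assms(2), of z] that by simp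
    then obtain e where "e \<in> edges C" "endp C (e, False) = z \<or> endp C (e, True) = z"
      using edge_deg_eq_0_iff[OF circuit_finite[OF assms(2)], of "endp C" z] by metis
    then show ?thesis using assms by (auto simp: finite_graph_def half_edges_def)
  qed
  then show ?thesis using assms by (auto simp: subgraph_def circuit_def)
qed

text \<open>With the two vertex sets as \<open>S\<close> and \<open>T\<close>,
  \<open>simple_path_between\<close> supplies a connecting path that meets each circuit in a single
  vertex.\<close>

lemma disjoint_unbalanced_circuits_long_barbell:
  assumes G: "finite_graph G" "connected_graph G"
    and C: "unbalanced_circuit \<sigma> C1" "unbalanced_circuit \<sigma> C2" "subgraph C1 G" "subgraph C2 G"
    and disj: "verts C1 \<inter> verts C2 = {}"
  shows "\<exists>B. subgraph B G \<and> long_barbell \<sigma> B"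
proof -
  obtain a b where ab: "a \<in> verts C1" "b \<in> verts C2"
    using C by (fastforce simp: unbalanced_circuit_def circuit_def connected_graph_def)
  then have "a \<in> verts G" "b \<in> verts G" using C by (auto simp: subgraph_def)
  then have "(a, b) \<in> (edge_adj (endp G) (edges G))\<^sup>*"
    using G(2) by (simp add: connected_graph_def adj_rel_eq_edge_adj)
  then obtain u v V E where P: "simple_path (endp G) v u V E" "E \<subseteq> edges G"
      "V \<inter> verts C1 = {u}" "V \<inter> verts C2 = {v}"
    using ab by (rule simple_path_between)
  define P' where "P' = \<lparr>verts = V, edges = E, endp = endp G\<rparr>"
  define B where "B = \<lparr>verts = verts C1 \<union> verts C2 \<union> V, edges = edges C1 \<union> edges C2 \<union> E, endp = endp G\<rparr>"
  have "u \<noteq> v" using P(3,4) disj by blast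
  have "V \<subseteq> verts G"
  proof
    fix z assume z: "z \<in> V"
    show "z \<in> verts G"
    \<comment> \<open>The ends lie on the circuits; any other path vertex has degree 2 in
      \<open>E\<close> and so is an end of an edge of \<open>G\<close>.\<close>
    proof (cases "z = u \<or> z = v")
      case True
      then show ?thesis using P(3,4) C(3,4) by (auto simp: subgraph_def)
    next
      case False
      then have "edge_deg (endp G) E z \<noteq> 0" using simple_path_deg[OF P(1), of z] z by auto
      then obtain e where "e \<in> E" "endp G (e, False) = z \<or> endp G (e, True) = z"
        using edge_deg_eq_0_iff[of E "endp G" z] simple_path_finite[OF P(1)] by metis
      then show ?thesis using P(2) G(1) by (auto simp: finite_graph_def half_edges_def)
    qed
  qed
  moreover have finP: "finite_graph P'"
    using simple_path_finite[OF P(1)] simple_path_incident[OF P(1)]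
    by (auto simp: P'_def finite_graph_def half_edges_def)
  ultimately have "subgraph B G"
    using C(3,4) P(2) by (auto simp: B_def P'_def subgraph_def finite_graph_def half_edges_def)
  moreover have "union_of B {C1, C2, P'}"
    using C(3,4) finP by (auto simp: union_of_def B_def P'_def subgraph_def)
  moreover have "path_graph P' u v"
    unfolding P'_def by (rule path_graph_of_simple_path[OF P(1)])
  moreover have "verts P' \<inter> verts C1 = {u}" "verts P' \<inter> verts C2 = {v}"
    using P(3,4) by (simp_all add: P'_def)
  ultimately show ?thesis unfolding long_barbell_def using C(1,2) disj by blast
qed

text \<open>The conclusion records even degrees and an even number of negative edges for
  \<open>H\<close>, so that \<open>F - edges H\<close> inherits the hypotheses on
  \<open>F\<close>.\<close>

lemma even_edge_set_contains_member:
  assumes G: "finite_graph G" "connected_graph G"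
    and nlb: "\<not> (\<exists>B. subgraph B G \<and> long_barbell \<sigma> B)"
    and F: "F \<subseteq> edges G" "F \<noteq> {}" "\<And>z. even (edge_deg (endp G) F z)"
    and neg: "even (card {e \<in> F. \<sigma> e = -1})"
  obtains H where "subgraph H G" "edges H \<subseteq> F" "edges H \<noteq> {}"
    "\<And>z. even (edge_deg (endp G) (edges H) z)" "even (card (neg_edges H \<sigma>))"
    "balanced_circuit \<sigma> H \<or> short_barbell \<sigma> H"
proof (cases "\<exists>C. balanced_circuit \<sigma> C \<and> edges C \<subseteq> F \<and> endp C = endp G")
  case True
  then obtain C where C: "balanced_circuit \<sigma> C" "edges C \<subseteq> F" "endp C = endp G" by blast
  then have circ: "circuit C" by (simp add: balanced_circuit_def)
  show thesis
  proof (rule that[of C])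
    show "subgraph C G" using circuit_subgraph[OF G(1) circ] C F(1) by blast
    show "even (edge_deg (endp G) (edges C) z)" for z using circuit_deg[OF circ, of z] C(3) by simp
  qed (use C circ circuit_edges_nonempty in \<open>auto simp: balanced_circuit_def\<close>)
next
  case False
  have finF: "finite F" using G(1) F(1) by (auto simp: finite_graph_def intro: finite_subset)
  have unb: "unbalanced_circuit \<sigma> C" if "circuit C" "edges C \<subseteq> F" "endp C = endp G" for C
    using False that by (auto simp: balanced_circuit_def unbalanced_circuit_def)
  obtain C1 where C1: "circuit C1" "edges C1 \<subseteq> F" "endp C1 = endp G"
    using even_edge_set_contains_circuit[OF finF F(2,3)] by blast
  have eq: "edges C1 \<union> (F - edges C1) = F" using C1(2) by blast
  have "odd (card {e \<in> edges C1. \<sigma> e = -1})"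
    using unb[OF C1] by (simp add: unbalanced_circuit_def neg_edges_def)
  \<comment> \<open>If \<open>C1\<close> used all of \<open>F\<close>, the number of negative edges
    in \<open>F\<close> would be odd.\<close>
  then have "F - edges C1 \<noteq> {}" using neg eq by force
  moreover have "even (edge_deg (endp G) (F - edges C1) z)" for z
    using edge_deg_Diff[OF finF C1(2), of "endp G" z] F(3)[of z] circuit_deg[OF C1(1), of z] C1(3)
    by simp
  ultimately obtain C2 where C2: "circuit C2" "edges C2 \<subseteq> F - edges C1" "endp C2 = endp G"
    using even_edge_set_contains_circuit[of "F - edges C1" "endp G"] finF by blast
  have C2F: "edges C2 \<subseteq> F" and disj: "edges C1 \<inter> edges C2 = {}" using C2(2) by blast+
  note u1 = unb[OF C1] and u2 = unb[OF C2(1) C2F C2(3)]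
  have s1: "subgraph C1 G" and s2: "subgraph C2 G"
    using circuit_subgraph[OF G(1)] C1 C2(1,3) C2F F(1) by blast+
  obtain x where x: "x \<in> verts C1" "x \<in> verts C2"
    using disjoint_unbalanced_circuits_long_barbell[OF G u1 u2 s1 s2] nlb by blast
  \<comment> \<open>A second common vertex would give a balanced circuit inside \<open>F\<close>,
    which the present case excludes.\<close>
  have "y = x" if y: "y \<in> verts C1" "y \<in> verts C2" for y
  proof (rule ccontr)
    assume "y \<noteq> x"
    then obtain C where "balanced_circuit \<sigma> C" "endp C = endp G" "edges C \<subseteq> edges C1 \<union> edges C2"
      using balanced_circuit_of_two_common_vertices[OF u1 u2 C1(3) C2(3) disj x y] by metis
    then show False using False C1(2) C2F by blast
  qed
  then have one: "verts C1 \<inter> verts C2 = {x}" using x by blast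
  define H where "H = \<lparr>verts = verts C1 \<union> verts C2, edges = edges C1 \<union> edges C2, endp = endp G\<rparr>"
  have fin: "finite (edges C1)" "finite (edges C2)" using C1 C2 circuit_finite by auto
  show thesis
  proof (rule that[of H])
    show "subgraph H G"
      using s1 s2 by (auto simp: H_def subgraph_def finite_graph_def half_edges_def)
    have "union_of H {C1, C2}"
      using s1 s2 by (auto simp: H_def union_of_def subgraph_def)
    then show "balanced_circuit \<sigma> H \<or> short_barbell \<sigma> H"
      unfolding short_barbell_def using u1 u2 one disj by blast
    show "edges H \<subseteq> F" "edges H \<noteq> {}"
      using C1 C2F circuit_edges_nonempty[OF C1(1)] by (auto simp: H_def)
    show "even (edge_deg (endp G) (edges H) z)" for z
      using edge_deg_Un[OF fin disj, of "endp G" z] circuit_deg[OF C1(1), of z]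
        circuit_deg[OF C2(1), of z] C1(3) C2(3) by (simp add: H_def)
    show "even (card (neg_edges H \<sigma>))"
      using card_neg_Un[OF fin disj, of \<sigma>] u1 u2
      by (simp add: H_def unbalanced_circuit_def neg_edges_def)
  qed
qed

text \<open>Induction on the finite set \<open>F\<close>: split off one member \<open>H\<close> and
  decompose the rest, which is strictly smaller because \<open>edges H\<close> is nonempty.\<close>

lemma even_edge_set_decomposition:
  assumes G: "finite_graph G" "connected_graph G"
    and nlb: "\<not> (\<exists>B. subgraph B G \<and> long_barbell \<sigma> B)"
    and "F \<subseteq> edges G" "\<And>z. even (edge_deg (endp G) F z)" "even (card {e \<in> F. \<sigma> e = -1})"
  shows "\<exists>\<C>. (\<forall>H\<in>\<C>. subgraph H G) \<and> (\<forall>H\<in>\<C>. \<forall>K\<in>\<C>. H \<noteq> K \<longrightarrow> edges H \<inter> edges K = {}) \<and>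
    (\<Union>H\<in>\<C>. edges H) = F \<and> (\<forall>H\<in>\<C>. balanced_circuit \<sigma> H \<or> short_barbell \<sigma> H)"
proof -
  have "finite F" using G(1) assms(4) by (auto simp: finite_graph_def intro: finite_subset)
  then show ?thesis using assms(4-6)
  proof (induction F rule: finite_psubset_induct)
    case (psubset F)
    show ?case
    proof (cases "F = {}")
      case True
      then show ?thesis by (intro exI[of _ "{}"]) auto
    next
      case False
      obtain H where H: "subgraph H G" "edges H \<subseteq> F" "edges H \<noteq> {}"
        "\<And>z. even (edge_deg (endp G) (edges H) z)" "even (card (neg_edges H \<sigma>))"
        "balanced_circuit \<sigma> H \<or> short_barbell \<sigma> H"
        using even_edge_set_contains_member[OF G nlb psubset.prems(1) False psubset.prems(2,3)] by blast
      have finH: "finite (edges H)" using H(2) psubset.hyps(1) finite_subset by blast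
      have eq: "edges H \<union> (F - edges H) = F" using H(2) by blast
      have sub: "F - edges H \<subset> F" "F - edges H \<subseteq> edges G" using H(2,3) psubset.prems(1) by blast+
      have deg: "even (edge_deg (endp G) (F - edges H) z)" for z
        using edge_deg_Diff[OF psubset.hyps(1) H(2), of "endp G" z] psubset.prems(2)[of z] H(4)[of z] by simp
      have neg: "even (card {e \<in> F - edges H. \<sigma> e = -1})"
      proof -
        have "card {e \<in> F. \<sigma> e = -1} =
            card {e \<in> edges H. \<sigma> e = -1} + card {e \<in> F - edges H. \<sigma> e = -1}"
          using card_neg_Un[OF finH finite_Diff[OF psubset.hyps(1)] Diff_disjoint, of \<sigma>] unfolding eq .
        then show ?thesis using psubset.prems(3) H(5) unfolding neg_edges_def by simp
      qed
      obtain \<C> where IH: "\<forall>H\<in>\<C>. subgraph H G"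
          "\<forall>H\<in>\<C>. \<forall>K\<in>\<C>. H \<noteq> K \<longrightarrow> edges H \<inter> edges K = {}"
          "(\<Union>H\<in>\<C>. edges H) = F - edges H" "\<forall>H\<in>\<C>. balanced_circuit \<sigma> H \<or> short_barbell \<sigma> H"
        using psubset.IH[OF sub deg neg] by metis
      \<comment> \<open>The members found by induction cover only \<open>F - edges H\<close>, so
        adding \<open>H\<close> keeps the family edge-disjoint.\<close>
      have "\<forall>K\<in>\<C>. edges K \<inter> edges H = {}" using IH(3) by blast
      then show ?thesis
        using IH H eq by (intro exI[of _ "insert H \<C>"]) (auto simp: Int_commute)
    qed
  qed
qed

theorem theorem4p2:
  fixes G :: "('v, 'e) graph" and \<sigma> :: "'e \<Rightarrow> int"
  assumes "finite_graph G" and "signature G \<sigma>"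
    and "connected_graph G"
    and "eulerian G"
    and "flow_admissible G \<sigma>"
    and "even (card (neg_edges G \<sigma>))"
    and "\<not> (\<exists>B. subgraph B G \<and> long_barbell \<sigma> B)"
  shows "\<exists>\<C>. decomposition G \<C> \<and>
           (\<forall>H\<in>\<C>. balanced_circuit \<sigma> H \<or> short_barbell \<sigma> H)"
proof -
  have fin: "finite (edges G)" using assms(1) by (simp add: finite_graph_def)
  \<comment> \<open>\<open>eulerian\<close> speaks of \<open>verts G\<close> only, whereas the
    induction wants all \<open>z\<close>; outside \<open>verts G\<close> the degree is 0.\<close>
  have deg: "even (edge_deg (endp G) (edges G) z)" for z
  proof (cases "z \<in> verts G")
    case True
    then show ?thesis using assms(4) degree_eq_edge_deg[OF fin] by (simp add: eulerian_def)
  next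
    case False
    then have "edge_deg (endp G) (edges G) z = 0"
      using assms(1) edge_deg_eq_0_iff[OF fin, of "endp G" z]
      by (auto simp: finite_graph_def half_edges_def)
    then show ?thesis by simp
  qed
  have neg: "even (card {e \<in> edges G. \<sigma> e = -1})" using assms(6) by (simp add: neg_edges_def)
  show ?thesis
    using even_edge_set_decomposition[OF assms(1,3,7) order.refl deg neg]
    unfolding decomposition_def by (simp only: conj_assoc)
qed

end
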